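(* Consider the standard model of floating point arithmetic satisfying the IEEE 754 standard, with set of floating point numbers $\mathbb{F}$. Let $$A=PLP^T,\qquad v=\widetilde\delta_1Pe_1,$$ where $P\in\mathbb{F}^{n\times n}$ is a signed permutation matrix, $\widetilde\delta_1\in\mathbb{F}$, and $L\in\mathbb{F}^{n\times n}$ is bidiagonal of the form $$L=\begin{bmatrix}\widetilde\gamma_1\\ \widetilde\delta_2 & \widetilde\gamma_2\\ & \ddots & \ddots\\ & & \widetilde\delta_n & \widetilde\gamma_n\end{bmatrix},$$ with $\widetilde\gamma_j,\widetilde\delta_j>0$ and $\widetilde\gamma_j^2,\widetilde\delta_j^2$ within the exponent range, $j=1,\dots,n$. Then the Golub-Kahan bidiagonalization applied to $A$ and $v$ in floating point arithmetic computes exactly. As a consequence, $L_n=L$, where $L_n$ is the bidiagonal matrix of the computed coefficients.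
   Context: **Floating point arithmetic.** $\mathbb{F}$ is the set of floating point numbers of an IEEE 754 binary format (e.g. binary64, binary32, binary16), with rounding to nearest. For $\alpha,\beta\in\mathbb{F}$ and a basic operation $\circ$ (addition, subtraction, multiplication, division; similarly the square root), $\mathrm{fl}(\alpha\circ\beta)$ is the floating point number nearest to the exact value; if the exact value is within the exponent range (no overflow or underflow), then $\mathrm{fl}(\alpha\circ\beta)=(\alpha\circ\beta)(1+\delta)$ with $|\delta|\le\mathbf{u}$, where $\mathbf{u}$ is the unit roundoff. A positive real number is within the exponent range if it lies between the smallest positive normalized and the largest finite floating point number. Inner products and matrix-vector products are evaluated as floating point sums of floating point products; the Euclidean norm $\|z\|$ is evaluated as the floating point square root of the floating point sum of the floating point squares of the entries. Signed zeros are identified. **Signed permutation matrix.** A permutation matrix in which the entries $1$ are replaced by $\pm1$. **Golub-Kahan bidiagonalization** (input: $A$, $v$). Set $w_0=0$ and $\delta_1s_1=v$. For $i=1,\dots,n$: $\gamma_iw_i=A^Ts_i-\delta_iw_{i-1}$; $\delta_{i+1}s_{i+1}=Aw_i-\gamma_is_i$. Here $\delta_i$ and $\gamma_i$ are normalization coefficients: each is the Euclidean norm of the right-hand side vector, and $s_i$ (resp. $w_i$) is that vector divided by its norm; the algorithm stops when a normalization coefficient is zero. $L_k$ is the $k\times k$ lower bidiagonal matrix with diagonal $\gamma_1,\dots,\gamma_k$ and subdiagonal $\delta_2,\dots,\delta_k$. **Computes exactly.** Every vector and coefficient produced in the lines of the algorithm, when computed in floating point arithmetic, coincides with the corresponding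 quantity produced by the algorithm in exact arithmetic. *)

theory Defs
  imports Complex_Main "HOL-Combinatorics.Permutations" "Jordan_Normal_Form.Matrix"
begin

section \<open>Floating point arithmetic\<close>

text \<open>
  An IEEE 754 binary format is given by its precision \<open>p\<close> and its maximal exponent \<open>emax\<close>; the
  minimal exponent is \<open>1 - emax\<close>. For instance binary64 is \<open>p = 53\<close>, \<open>emax = 1023\<close>.
\<close>

definition ieee_binary_format :: "nat \<Rightarrow> nat \<Rightarrow> bool" where
  "ieee_binary_format p emax \<longleftrightarrow> 2 \<le> p \<and> 1 \<le> emax"

text \<open>
  The finite floating point numbers, normalized and subnormal, with signed zeros identified.
  The significand is scaled to an integer, which shifts the exponent range by \<open>p - 1\<close>.
\<close>

definition fp_numbers :: "nat \<Rightarrow> nat \<Rightarrow> real set" where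
  "fp_numbers p emax = {real_of_int m * 2 powi e | m e :: int.
     \<bar>m\<bar> < 2 ^ p \<and> 1 - int emax - (int p - 1) \<le> e \<and> e \<le> int emax - (int p - 1)}"

definition min_normal :: "nat \<Rightarrow> real" where
  "min_normal emax = 2 powi (1 - int emax)"

definition max_finite :: "nat \<Rightarrow> nat \<Rightarrow> real" where
  "max_finite p emax = (2 - 2 powi (1 - int p)) * 2 ^ emax"

definition within_exponent_range :: "nat \<Rightarrow> nat \<Rightarrow> real \<Rightarrow> bool" where
  "within_exponent_range p emax x \<longleftrightarrow> min_normal emax \<le> x \<and> x \<le> max_finite p emax"

text \<open>No rule for breaking ties is prescribed.\<close>

definition rounds_to_nearest :: "nat \<Rightarrow> nat \<Rightarrow> (real \<Rightarrow> real) \<Rightarrow> bool" where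
  "rounds_to_nearest p emax rnd \<longleftrightarrow>
     (\<forall>x. rnd x \<in> fp_numbers p emax \<and> (\<forall>y \<in> fp_numbers p emax. \<bar>x - rnd x\<bar> \<le> \<bar>x - y\<bar>))"

text \<open>
  A computed quantity has type \<^typ>\<open>real option\<close>: \<^term>\<open>Some x\<close> is the finite number \<^term>\<open>x\<close>, and
  \<^const>\<open>None\<close> stands for any exceptional outcome (infinity or NaN). Exceptional operands
  give exceptional results; this is stricter than IEEE 754, where a finite number can arise from an
  infinite operand, so that a result \<^term>\<open>Some x\<close> certifies that no exception has occurred on the way.
  The overflow threshold below, half a unit in the last place above the largest
  finite number, is the one of IEEE 754 for rounding to nearest.
\<close>

definition fl :: "nat \<Rightarrow> nat \<Rightarrow> (real \<Rightarrow> real) \<Rightarrow> real \<Rightarrow> real option" where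
  "fl p emax rnd x =
     (if \<bar>x\<bar> < (2 - 2 powi (- int p)) * 2 ^ emax then Some (rnd x) else None)"

text \<open>In the following the argument \<open>f\<close> is the function \<^term>\<open>fl p emax rnd\<close>.\<close>

definition fp_add :: "(real \<Rightarrow> real option) \<Rightarrow> real option \<Rightarrow> real option \<Rightarrow> real option" where
  "fp_add f x y = Option.bind x (\<lambda>a. Option.bind y (\<lambda>b. f (a + b)))"

definition fp_sub :: "(real \<Rightarrow> real option) \<Rightarrow> real option \<Rightarrow> real option \<Rightarrow> real option" where
  "fp_sub f x y = Option.bind x (\<lambda>a. Option.bind y (\<lambda>b. f (a - b)))"

definition fp_mult :: "(real \<Rightarrow> real option) \<Rightarrow> real option \<Rightarrow> real option \<Rightarrow> real option" where
  "fp_mult f x y = Option.bind x (\<lambda>a. Option.bind y (\<lambda>b. f (a * b)))"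

definition fp_div :: "(real \<Rightarrow> real option) \<Rightarrow> real option \<Rightarrow> real option \<Rightarrow> real option" where
  "fp_div f x y =
     Option.bind x (\<lambda>a. Option.bind y (\<lambda>b. if b = 0 then None else f (a / b)))"

definition fp_sqrt :: "(real \<Rightarrow> real option) \<Rightarrow> real option \<Rightarrow> real option" where
  "fp_sqrt f x = Option.bind x (\<lambda>a. if a < 0 then None else f (sqrt a))"

text \<open>
  \<open>fp_sum f X x\<close> says that \<open>x\<close> is a value obtained by adding up the members of \<open>X\<close> in floating point
  arithmetic, in some order and with some bracketing. A summation algorithm is any function that
  chooses such a value for each nonempty list of summands.
\<close>

inductive fp_sum :: "(real \<Rightarrow> real option) \<Rightarrow> real option multiset \<Rightarrow> real option \<Rightarrow> bool"
  for f where
  single: "fp_sum f {#x#} x"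
| add: "fp_sum f X x \<Longrightarrow> fp_sum f Y y \<Longrightarrow> fp_sum f (X + Y) (fp_add f x y)"

definition summation_algorithm ::
  "(real \<Rightarrow> real option) \<Rightarrow> (real option list \<Rightarrow> real option) \<Rightarrow> bool" where
  "summation_algorithm f sm \<longleftrightarrow> (\<forall>xs. xs \<noteq> [] \<longrightarrow> fp_sum f (mset xs) (sm xs))"

section \<open>Golub-Kahan bidiagonalization\<close>

text \<open>
  The algorithm is written once, over a record of vector operations, and then run in exact and in
  floating point arithmetic.
\<close>

record 'a vec_arith =
  azero :: 'a
  matvec :: "'a mat \<Rightarrow> 'a vec \<Rightarrow> 'a vec"
  vscale :: "'a \<Rightarrow> 'a vec \<Rightarrow> 'a vec"
  vsub :: "'a vec \<Rightarrow> 'a vec \<Rightarrow> 'a vec"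
  vnorm :: "'a vec \<Rightarrow> 'a"
  vdiv :: "'a vec \<Rightarrow> 'a \<Rightarrow> 'a vec"

definition exact_arith :: "real vec_arith" where
  "exact_arith = \<lparr>
     azero = 0,
     matvec = (\<lambda>A x. A *\<^sub>v x),
     vscale = (\<lambda>c x. c \<cdot>\<^sub>v x),
     vsub = (\<lambda>x y. x - y),
     vnorm = (\<lambda>x. sqrt (x \<bullet> x)),
     vdiv = (\<lambda>x c. (1 / c) \<cdot>\<^sub>v x)\<rparr>"

definition fp_inner ::
  "(real \<Rightarrow> real option) \<Rightarrow> (real option list \<Rightarrow> real option)
     \<Rightarrow> real option vec \<Rightarrow> real option vec \<Rightarrow> real option" where
  "fp_inner f sm x y = sm (map (\<lambda>i. fp_mult f (x $ i) (y $ i)) [0..<dim_vec y])"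

definition fp_arith ::
  "(real \<Rightarrow> real option) \<Rightarrow> (real option list \<Rightarrow> real option) \<Rightarrow> real option vec_arith" where
  "fp_arith f sm = \<lparr>
     azero = Some 0,
     matvec = (\<lambda>A x. vec (dim_row A) (\<lambda>i. fp_inner f sm (row A i) x)),
     vscale = (\<lambda>c x. vec (dim_vec x) (\<lambda>i. fp_mult f c (x $ i))),
     vsub = (\<lambda>x y. vec (dim_vec y) (\<lambda>i. fp_sub f (x $ i) (y $ i))),
     vnorm = (\<lambda>x. fp_sqrt f (fp_inner f sm x x)),
     vdiv = (\<lambda>x c. vec (dim_vec x) (\<lambda>i. fp_div f (x $ i) c))\<rparr>"

text \<open>
  What one line of the algorithm produces: the right-hand side vector, its norm (the normalization
  coefficient), and the normalized vector, which is missing if the coefficient is zero.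
\<close>

datatype 'a gk_line = GK_Line (gk_rhs: "'a vec") (gk_coeff: 'a) (gk_vec: "'a vec option")

definition normalize_line :: "'a vec_arith \<Rightarrow> 'a vec \<Rightarrow> 'a gk_line" where
  "normalize_line R u =
     (let c = vnorm R u
      in GK_Line u c (if c = azero R then None else Some (vdiv R u c)))"

text \<open>
  \<open>gk_loop R A k d s w\<close> performs up to \<open>k\<close> further iterations, starting from the current coefficient
  \<open>d = \<delta>\<^sub>i\<close> and the current vectors \<open>s = s\<^sub>i\<close>, \<open>w = w\<^sub>i\<^sub>-\<^sub>1\<close>. The first component of the result lists
  the lines for \<open>\<delta>\<^sub>i\<^sub>+\<^sub>1 s\<^sub>i\<^sub>+\<^sub>1\<close>, the second one the lines for \<open>\<gamma>\<^sub>i w\<^sub>i\<close>.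
\<close>

fun gk_loop :: "'a vec_arith \<Rightarrow> 'a mat \<Rightarrow> nat \<Rightarrow> 'a \<Rightarrow> 'a vec \<Rightarrow> 'a vec
    \<Rightarrow> 'a gk_line list \<times> 'a gk_line list" where
  "gk_loop R A 0 d s w = ([], [])"
| "gk_loop R A (Suc k) d s w =
     (let g = normalize_line R (vsub R (matvec R (transpose_mat A) s) (vscale R d w))
      in case gk_vec g of
           None \<Rightarrow> ([], [g])
         | Some w' \<Rightarrow>
             (let h = normalize_line R (vsub R (matvec R A w') (vscale R (gk_coeff g) s))
              in case gk_vec h of
                   None \<Rightarrow> ([h], [g])
                 | Some s' \<Rightarrow>
                     (let (ds, gs) = gk_loop R A k (gk_coeff h) s' w' in (h # ds, g # gs))))"

definition golub_kahan ::
  "'a vec_arith \<Rightarrow> 'a mat \<Rightarrow> 'a vec \<Rightarrow> 'a gk_line list \<times> 'a gk_line list" where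
  "golub_kahan R A v =
     (let h = normalize_line R v
      in case gk_vec h of
           None \<Rightarrow> ([h], [])
         | Some s \<Rightarrow>
             (let (ds, gs) = gk_loop R A (dim_row A) (gk_coeff h) s (vec (dim_col A) (\<lambda>_. azero R))
              in (h # ds, gs)))"

text \<open>
  Matrices are indexed from 0, so row \<open>i\<close> holds \<open>\<gamma>\<^sub>i\<^sub>+\<^sub>1\<close> and \<open>\<delta>\<^sub>i\<^sub>+\<^sub>1\<close>, which are the entries number \<open>i\<close>
  of the two lists of lines. Meaningful only if at least \<open>k\<close> lines of each kind were produced.
\<close>

definition gk_bidiag ::
  "'a vec_arith \<Rightarrow> nat \<Rightarrow> 'a gk_line list \<times> 'a gk_line list \<Rightarrow> 'a mat" where
  "gk_bidiag R k out = mat k k (\<lambda>(i, j).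
     if i = j then gk_coeff (snd out ! i)
     else if i = Suc j then gk_coeff (fst out ! i)
     else azero R)"

definition line_some :: "'a gk_line \<Rightarrow> 'a option gk_line" where
  "line_some l =
     GK_Line (map_vec Some (gk_rhs l)) (Some (gk_coeff l)) (map_option (map_vec Some) (gk_vec l))"

text \<open>
  In particular both runs produce the same number of lines, that is, they stop at the same point.
\<close>

definition gk_computes_exactly ::
  "(real \<Rightarrow> real option) \<Rightarrow> (real option list \<Rightarrow> real option) \<Rightarrow> real mat \<Rightarrow> real vec \<Rightarrow> bool"
  where
  "gk_computes_exactly f sm A v \<longleftrightarrow>
     golub_kahan (fp_arith f sm) (map_mat Some A) (map_vec Some v) =
     map_prod (map line_some) (map line_some) (golub_kahan exact_arith A v)"

section \<open>Matrices\<close>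

definition permutation_mat :: "nat \<Rightarrow> real mat \<Rightarrow> bool" where
  "permutation_mat n Q \<longleftrightarrow>
     (\<exists>\<pi>. \<pi> permutes {..<n} \<and> Q = mat n n (\<lambda>(i, j). if i = \<pi> j then 1 else 0))"

definition signed_permutation_mat :: "nat \<Rightarrow> real mat \<Rightarrow> bool" where
  "signed_permutation_mat n P \<longleftrightarrow> P \<in> carrier_mat n n \<and>
     (\<exists>Q. permutation_mat n Q \<and>
       (\<forall>i < n. \<forall>j < n. if Q $$ (i, j) = 1 then P $$ (i, j) \<in> {1, - 1} else P $$ (i, j) = 0))"

text \<open>The sequences are indexed from 1; \<open>\<delta> 1\<close> does not occur in the matrix.\<close>

definition lower_bidiag_mat :: "nat \<Rightarrow> (nat \<Rightarrow> real) \<Rightarrow> (nat \<Rightarrow> real) \<Rightarrow> real mat" where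
  "lower_bidiag_mat n \<gamma> \<delta> = mat n n (\<lambda>(i, j).
     if i = j then \<gamma> (Suc i) else if i = Suc j then \<delta> (Suc i) else 0)"

end

theory Submission
  imports Defs
begin

text \<open>
  Let \<open>q\<^sub>j\<close> be the \<open>j\<close>-th column of \<open>P\<close>. Since \<open>P\<close> is orthogonal, \<open>A = P L P\<^sup>T\<close> gives
  \<open>A q\<^sub>j = \<gamma>\<^sub>j q\<^sub>j + \<delta>\<^sub>j\<^sub>+\<^sub>1 q\<^sub>j\<^sub>+\<^sub>1\<close> and \<open>A\<^sup>T q\<^sub>j = \<gamma>\<^sub>j q\<^sub>j + \<delta>\<^sub>j q\<^sub>j\<^sub>-\<^sub>1\<close>, with the terms outside the index range
  missing. So exact bidiagonalization, started with \<open>v = \<delta>\<^sub>1 q\<^sub>1\<close>, produces \<open>s\<^sub>j = w\<^sub>j = q\<^sub>j\<close>, and its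
  coefficients are those of \<open>L\<close>. It stops at \<open>A q\<^sub>n - \<gamma>\<^sub>n q\<^sub>n = 0\<close>.

  In floating point arithmetic, an operation is exact as soon as its exact result is representable.
  Every \<open>q\<^sub>j\<close> is a coordinate vector up to sign, and different \<open>q\<^sub>j\<close> have different supports. All
  sums therefore have at most one nonzero summand, all subtractions cancel completely or subtract
  zero, and the results are zeros and coefficients \<open>\<gamma>\<^sub>j\<close>, \<open>\<delta>\<^sub>j\<close> up to sign
  (\<open>residual_of_two_term_product\<close>). The divisions of the normalization return 0 and \<open>\<plusminus>1\<close>.

  The norm is the exception: for a vector \<open>c q\<^sub>j\<close> it is the rounded square root of the rounded square
  of \<open>c\<close>. In binary arithmetic this is \<open>c\<close> again if \<open>c\<^sup>2\<close> is within the exponent range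
  (\<open>sqrt_of_rounded_square\<close>): a square root roughly halves relative errors, so it
  stays within half a unit in the last place of \<open>c\<close>.

  Both runs are obtained from one description of the loop over an arbitrary arithmetic
  (\<open>golub_kahan_lines\<close>).
\<close>

section \<open>Representable numbers and rounding\<close>

lemma two_powi_less_cancel: "(2::real) powi a < 2 powi b \<Longrightarrow> a < b"
  using power_int_increasing[of b a "2::real"] by (meson leD leI one_le_numeral)

lemma two_powi_add: "(2::real) powi (a + b) = 2 powi a * 2 powi b"
  by (simp add: power_int_add)

lemma two_powi_double: "(2::real) powi (2 * a) = (2 powi a)\<^sup>2"
  using two_powi_add[of a a] by (simp add: power2_eq_square)

locale rounding_format =
  fixes p emax :: nat
    and rnd :: "real \<Rightarrow> real"
    and sm :: "real option list \<Rightarrow> real option"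
  assumes format: "ieee_binary_format p emax"
    and nearest: "rounds_to_nearest p emax rnd"
    and summation: "summation_algorithm (fl p emax rnd) sm"
begin


abbreviation F :: "real set" where "F \<equiv> fp_numbers p emax"
abbreviation f :: "real \<Rightarrow> real option" where "f \<equiv> fl p emax rnd"

lemma precision_ge: "2 \<le> p" and emax_ge: "1 \<le> emax"
  using format by (auto simp: ieee_binary_format_def)

lemma two_power_precision: "(2::real) ^ p = 2 * 2 powi (int p - 1)"
  using two_powi_add[of 1 "int p - 1"] by (simp add: power_int_def)

lemma real_less_two_power_iff: "real_of_int m < 2 ^ p \<longleftrightarrow> m < 2 ^ p"
  by (metis of_int_less_iff of_int_numeral of_int_power)

lemma max_finite_eq: "max_finite p emax = (2 ^ p - 1) * 2 powi (int emax - (int p - 1))"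
proof -
  have a: "(2::real) powi (int emax - (int p - 1)) = 2 ^ emax * 2 powi (1 - int p)"
    using two_powi_add[of "int emax" "1 - int p"] by (simp add: algebra_simps)
  have "(2::real) ^ p * 2 powi (1 - int p) = 2"
    using two_powi_add[of "int p" "1 - int p"] by simp
  then show ?thesis
    unfolding max_finite_def a by (simp add: algebra_simps)
qed

lemma max_finite_less: "max_finite p emax < (2 - 2 powi (- int p)) * 2 ^ emax"
proof -
  have "(2::real) powi (- int p) < 2 powi (1 - int p)"
    by (rule power_int_strict_increasing) auto
  then show ?thesis unfolding max_finite_def by simp
qed

lemma one_le_max_finite: "1 \<le> max_finite p emax"
proof -
  have "(2::real) powi (1 - int p) \<le> 2 powi 0"
    using precision_ge by (intro power_int_increasing) auto
  then have "1 * 1 \<le> max_finite p emax"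
    unfolding max_finite_def by (intro mult_mono) auto
  then show ?thesis by simp
qed

lemma representableI: "\<bar>m\<bar> < 2 ^ p \<Longrightarrow> 1 - int emax - (int p - 1) \<le> e \<Longrightarrow> e \<le> int emax - (int p - 1) \<Longrightarrow>
    real_of_int m * 2 powi e \<in> F"
  unfolding fp_numbers_def by blast

lemma representableE:
  assumes "x \<in> F"
  obtains m e where "x = real_of_int m * 2 powi e" "\<bar>m\<bar> < 2 ^ p"
    "1 - int emax - (int p - 1) \<le> e" "e \<le> int emax - (int p - 1)"
  using assms that unfolding fp_numbers_def by auto

lemma zero_representable [simp]: "0 \<in> F"
  using representableI[of 0 "1 - int emax - (int p - 1)"] emax_ge by simp

lemma uminus_representable: "x \<in> F \<Longrightarrow> - x \<in> F"
  by (metis representableE representableI abs_minus_cancel mult_minus_left of_int_minus)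

lemma representable_abs_le_max_finite:
  assumes "x \<in> F"
  shows "\<bar>x\<bar> \<le> max_finite p emax"
proof -
  obtain m e where x: "x = real_of_int m * 2 powi e" and m: "\<bar>m\<bar> < 2 ^ p"
    and e: "e \<le> int emax - (int p - 1)"
    using assms by (rule representableE)
  have "\<bar>m\<bar> \<le> 2 ^ p - 1" using m by simp
  then have "real_of_int \<bar>m\<bar> \<le> of_int (2 ^ p - 1)" by (rule of_int_le_iff[THEN iffD2])
  then have "real_of_int \<bar>m\<bar> \<le> 2 ^ p - 1" by simp
  moreover have "(2::real) powi e \<le> 2 powi (int emax - (int p - 1))"
    using e by (intro power_int_increasing) auto
  ultimately have "real_of_int \<bar>m\<bar> * 2 powi e \<le> (2 ^ p - 1) * 2 powi (int emax - (int p - 1))"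
    by (intro mult_mono) auto
  then show ?thesis unfolding max_finite_eq x by (simp add: abs_mult)
qed

lemma rnd_is_representable: "rnd x \<in> F"
  using nearest by (simp add: rounds_to_nearest_def)

lemma rnd_nearest: "y \<in> F \<Longrightarrow> \<bar>x - rnd x\<bar> \<le> \<bar>x - y\<bar>"
  using nearest by (simp add: rounds_to_nearest_def)

lemma rnd_representable: "x \<in> F \<Longrightarrow> rnd x = x"
  using rnd_nearest[of x x] by simp

lemma fl_no_overflow: "\<bar>x\<bar> \<le> max_finite p emax \<Longrightarrow> f x = Some (rnd x)"
  using max_finite_less by (simp add: fl_def)

lemma fl_representable: "x \<in> F \<Longrightarrow> f x = Some x"
  by (simp add: fl_no_overflow representable_abs_le_max_finite rnd_representable)

text \<open>
  Doubling the significand and lowering the exponent leads to a significand with its leading bit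
  set, unless the least exponent is reached first; there \<^term>\<open>min_normal emax \<le> x\<close> says that the
  leading bit is already set. The induction is on the distance to the least exponent.
\<close>

lemma normalized_representation:
  assumes "x \<in> F" "min_normal emax \<le> x"
  obtains m e where "x = real_of_int m * 2 powi e" "2 powi (int p - 1) \<le> real_of_int m"
    "real_of_int m < 2 ^ p"
    "1 - int emax - (int p - 1) \<le> e" "e \<le> int emax - (int p - 1)"
proof -
  have "\<exists>m e. x = real_of_int m * 2 powi e \<and> 2 powi (int p - 1) \<le> real_of_int m \<and>
      real_of_int m < 2 ^ p \<and> 1 - int emax - (int p - 1) \<le> e \<and> e \<le> int emax - (int p - 1)"
    if "x = real_of_int m * 2 powi (1 - int emax - (int p - 1) + int k)" "\<bar>m\<bar> < 2 ^ p"
      "1 - int emax - (int p - 1) + int k \<le> int emax - (int p - 1)" for m k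
    using that
  proof (induction k arbitrary: m)
    case 0
    have "2 powi (int p - 1) * 2 powi (1 - int emax - (int p - 1))
        \<le> real_of_int m * 2 powi (1 - int emax - (int p - 1))"
      using assms(2) 0(1) two_powi_add[of "int p - 1" "1 - int emax - (int p - 1)"]
      by (simp add: min_normal_def)
    then have "2 powi (int p - 1) \<le> real_of_int m" by simp
    moreover have "real_of_int m < 2 ^ p" using 0(2) by (simp add: real_less_two_power_iff)
    ultimately show ?case using 0 by (intro exI[of _ m] exI) auto
  next
    case (Suc k)
    let ?e = "1 - int emax - (int p - 1) + int k"
    show ?case
    proof (cases "2 powi (int p - 1) \<le> real_of_int m")
      case True
      moreover have "real_of_int m < 2 ^ p" using Suc(3) by (simp add: real_less_two_power_iff)
      ultimately show ?thesis using Suc(2-4) by (intro exI[of _ m] exI) auto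
    next
      case False
      have x: "x = real_of_int (2 * m) * 2 powi ?e"
        using Suc(2) two_powi_add[of ?e 1] by (simp add: algebra_simps)
      have "0 < x"
        using assms(2) by (rule less_le_trans[rotated]) (simp add: min_normal_def)
      then have "0 < real_of_int (2 * m)"
        unfolding x by (rule zero_less_mult_pos2) simp
      then have "0 < m" by simp
      moreover have "real_of_int (2 * m) < 2 ^ p" using False two_power_precision by simp
      ultimately have "\<bar>2 * m\<bar> < 2 ^ p" unfolding real_less_two_power_iff by simp
      then show ?thesis using x Suc(4) by (intro Suc.IH) auto
    qed
  qed
  moreover obtain m e where "x = real_of_int m * 2 powi e" "\<bar>m\<bar> < 2 ^ p"
    "1 - int emax - (int p - 1) \<le> e" "e \<le> int emax - (int p - 1)"
    using assms(1) by (rule representableE)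
  ultimately have "\<exists>m e. x = real_of_int m * 2 powi e \<and> 2 powi (int p - 1) \<le> real_of_int m \<and>
      real_of_int m < 2 ^ p \<and> 1 - int emax - (int p - 1) \<le> e \<and> e \<le> int emax - (int p - 1)"
    by (metis zle_iff_zadd)
  then show thesis using that by blast
qed

text \<open>
  The nearest multiple of \<open>2\<^sup>e\<close> is representable: its significand has at most \<open>p\<close> bits, except when
  it is \<open>2\<^sup>p\<close>. That case is a carry into the next binade, which exists because numbers up to
  \<^term>\<open>max_finite p emax\<close> do not round beyond it.
\<close>

lemma half_ulp_error:
  assumes "0 \<le> x" "x \<le> 2 ^ p * 2 powi e" "x \<le> max_finite p emax"
    and e: "1 - int emax - (int p - 1) \<le> e" "e \<le> int emax - (int p - 1)"
  shows "\<bar>x - rnd x\<bar> \<le> 2 powi e / 2"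
proof -
  define K where "K = round (x / 2 powi e)"
  have pos: "(0::real) < 2 powi e" by simp
  have near: "\<bar>x - of_int K * 2 powi e\<bar> \<le> 2 powi e / 2"
  proof -
    have "x - of_int K * 2 powi e = (x / 2 powi e - of_int K) * 2 powi e"
      by (simp add: field_simps)
    then have "\<bar>x - of_int K * 2 powi e\<bar> = \<bar>of_int K - x / 2 powi e\<bar> * 2 powi e"
      by (simp add: abs_mult abs_minus_commute)
    also have "\<dots> \<le> 1 / 2 * 2 powi e"
      unfolding K_def using of_int_round_abs_le by (intro mult_right_mono) auto
    finally show ?thesis by simp
  qed
  have K0: "0 \<le> K"
    using round_mono[of 0 "x / 2 powi e"] assms(1) by (simp add: K_def)
  have "x / 2 powi e \<le> of_int (2 ^ p)"
    using assms(2) by (simp add: divide_simps)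
  then have Kp: "K \<le> 2 ^ p"
    using round_mono[of "x / 2 powi e" "of_int (2 ^ p)"] unfolding K_def round_of_int by simp
  have "of_int K * 2 powi e \<in> F"
  proof (cases "K = 2 ^ p")
    case False
    then show ?thesis using K0 Kp e by (intro representableI) auto
  next
    case True
    have "e \<noteq> int emax - (int p - 1)"
    proof
      assume "e = int emax - (int p - 1)"
      then have "x / 2 powi e \<le> of_int (2 ^ p - 1)"
        using assms(3) by (simp add: max_finite_eq divide_simps)
      then have "K \<le> 2 ^ p - 1"
        using round_mono[of "x / 2 powi e" "of_int (2 ^ p - 1)"] unfolding K_def round_of_int by simp
      then show False using True by simp
    qed
    \<comment> \<open>The candidate is a power of two and can be written with the next larger exponent.\<close>
    then have "of_int (2 ^ (p - 1)) * 2 powi (e + 1) \<in> F"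
      using e precision_ge by (intro representableI) auto
    moreover have "(2::real) ^ p = 2 * 2 ^ (p - 1)"
      using precision_ge by (cases p) auto
    ultimately show ?thesis using True two_powi_add[of e 1] by (simp add: mult_ac)
  qed
  from order_trans[OF rnd_nearest[OF this] near] show ?thesis .
qed

text \<open>
  Away from powers of two, both neighbours of a normalized number are one unit in the last place
  away. Below a power of two the spacing is halved in general, which is why the significand must
  exceed \<open>2\<^sup>p\<^sup>-\<^sup>1\<close> strictly.
\<close>

lemma representable_within_ulp_eq:
  assumes "z \<in> F" and x: "x = real_of_int m * 2 powi e" and m: "2 powi (int p - 1) < real_of_int m"
    and near: "\<bar>z - x\<bar> < 2 powi e"
  shows "z = x"
proof -
  obtain m' e' where z: "z = real_of_int m' * 2 powi e'" and m': "\<bar>m'\<bar> < 2 ^ p"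
    using assms(1) by (rule representableE)
  show ?thesis
  proof (cases "e \<le> e'")
    case True
    define d where "d = nat (e' - e)"
    have "e' = e + int d" using True by (simp add: d_def)
    then have z': "z = real_of_int (m' * 2 ^ d) * 2 powi e"
      using z two_powi_add[of e "int d"] by simp
    have "z - x = real_of_int (m' * 2 ^ d - m) * 2 powi e"
      unfolding z' x of_int_diff by (simp add: algebra_simps)
    then have "real_of_int \<bar>m' * 2 ^ d - m\<bar> * 2 powi e < 1 * 2 powi e"
      using near by (simp add: abs_mult)
    then have "real_of_int \<bar>m' * 2 ^ d - m\<bar> < 1" by (rule mult_right_less_imp_less) simp
    then have "m' * 2 ^ d = m" by linarith
    then show ?thesis using z' x by simp
  next
    case False
    \<comment> \<open>A smaller exponent confines \<^term>\<open>z\<close> below the binade of \<^term>\<open>x\<close>, and \<^term>\<open>x\<close> is not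
      the least number of its binade.\<close>
    define M where "M = nat (int p - 1)"
    have M: "(2::real) powi (int p - 1) = of_int (2 ^ M)"
      using precision_ge by (simp add: M_def power_int_def nat_diff_distrib)
    have "2 ^ M < m" using m unfolding M by (simp only: of_int_less_iff)
    then have "real_of_int (2 ^ M + 1) \<le> real_of_int m" by (simp only: of_int_le_iff)
    then have xm: "(2 powi (int p - 1) + 1) * 2 powi e \<le> x"
      unfolding x M by (intro mult_right_mono) auto
    have "real_of_int m' < 2 ^ p" using m' by (simp add: real_less_two_power_iff)
    then have "z \<le> 2 ^ p * 2 powi e'"
      unfolding z by (intro mult_right_mono) auto
    also have "\<dots> = 2 powi (int p - 1) * 2 powi (e' + 1)"
      using two_powi_add[of e' 1] by (simp add: two_power_precision)
    also have "\<dots> \<le> 2 powi (int p - 1) * 2 powi e"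
      using False by (intro mult_left_mono power_int_increasing) auto
    finally show ?thesis using xm near by (simp add: algebra_simps)
  qed
qed

text \<open>
  Let \<open>x = m c\<close> with \<open>c = 2\<^sup>e\<close> and \<open>M = 2\<^sup>p\<^sup>-\<^sup>1 \<le> m < 2 M\<close>, and let \<open>y\<close> be the rounded square.
  Rounding moves \<open>x\<^sup>2\<close> by at most half a unit of its binade, which is \<open>M c\<^sup>2 / 2\<close> if \<open>m\<^sup>2 < 2 M\<^sup>2\<close> and
  \<open>M c\<^sup>2\<close> otherwise. If \<open>m > M\<close>, dividing by \<open>sqrt y + x\<close>, which exceeds \<open>M c\<close> and \<open>2 M c\<close> respectively,
  shows that \<open>sqrt y\<close> is closer to \<open>x\<close> than \<open>c / 2\<close>. All other representable numbers are at least
  \<open>c\<close> away from \<open>x\<close>, so \<open>sqrt y\<close> rounds to \<open>x\<close>. If \<open>m = M\<close>, then \<open>x\<close> is a power of two and its square is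
  exact. The exponent range assumption makes the binade of \<open>x\<^sup>2\<close> one of the format.
\<close>

lemma sqrt_of_rounded_square:
  assumes "x \<in> F" "0 < x" and range: "within_exponent_range p emax (x\<^sup>2)"
  shows "rnd (sqrt (rnd (x\<^sup>2))) = x"
proof -
  have sq: "min_normal emax \<le> x\<^sup>2" "x\<^sup>2 \<le> max_finite p emax"
    using range by (auto simp: within_exponent_range_def)
  have "min_normal emax \<le> x"
  proof (cases "x \<le> 1")
    case True
    then have "x\<^sup>2 \<le> x" using assms(2) by (simp add: power2_eq_square mult_left_le)
    then show ?thesis using sq by simp
  next
    case False
    have "(2::real) powi (1 - int emax) \<le> 2 powi 0"
      using emax_ge by (intro power_int_increasing) auto
    then show ?thesis using False by (simp add: min_normal_def)
  qed
  then obtain m e where x: "x = real_of_int m * 2 powi e" and m: "2 powi (int p - 1) \<le> real_of_int m"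
      "real_of_int m < 2 ^ p" and e: "1 - int emax - (int p - 1) \<le> e" "e \<le> int emax - (int p - 1)"
    using normalized_representation[OF assms(1)] by metis
  define M where "M = (2::real) powi (int p - 1)"
  define c where "c = (2::real) powi e"
  define y where "y = rnd (x\<^sup>2)"
  have M: "2 \<le> M"
    using power_int_increasing[of 1 "int p - 1" "2::real"] precision_ge by (simp add: M_def)
  have c: "0 < c" by (simp add: c_def)
  have mM: "M \<le> real_of_int m" using m by (simp add: M_def)
  have xc: "x = real_of_int m * c" by (simp add: x c_def)
  have x2: "x\<^sup>2 = (real_of_int m)\<^sup>2 * c\<^sup>2" by (simp add: xc power_mult_distrib)
  have Mc: "M\<^sup>2 * c\<^sup>2 = 2 powi (2 * e + 2 * (int p - 1))"
    unfolding M_def c_def two_powi_add two_powi_double by (simp add: algebra_simps)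
  have top: "max_finite p emax < 2 powi (int emax + 1)"
    using two_powi_add[of "int emax" 1] by (simp add: max_finite_def algebra_simps)
  have M2: "M\<^sup>2 \<le> (real_of_int m)\<^sup>2" using mM M by (intro power_mono) auto
  \<comment> \<open>Factor \<open>y - x\<^sup>2 = (sqrt y - x) (sqrt y + x)\<close>; here \<open>h\<close> is \<open>M c\<close> or \<open>2 M c\<close>.\<close>
  have close: "\<bar>sqrt y - x\<bar> < c / 2" 
    if "0 \<le> y" "\<bar>x\<^sup>2 - y\<bar> \<le> h * (c / 2)" "h < sqrt y + x" "0 < h" for h
  proof (rule ccontr)
    assume "\<not> ?thesis"
    then have "(c / 2) * h < \<bar>sqrt y - x\<bar> * (sqrt y + x)"
      using that c by (intro mult_le_less_imp_less) auto
    also have "\<dots> = \<bar>(sqrt y - x) * (sqrt y + x)\<bar>"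
      using that by (simp add: abs_mult)
    also have "\<dots> = \<bar>x\<^sup>2 - y\<bar>"
      using that(1) by (simp add: algebra_simps power2_eq_square abs_minus_commute)
    finally show False using that by (simp add: mult.commute)
  qed
  have finish: "rnd (sqrt y) = x" if "\<bar>sqrt y - x\<bar> < c / 2" "M < real_of_int m"
  proof (rule representable_within_ulp_eq[OF rnd_is_representable x])
    show "2 powi (int p - 1) < real_of_int m" using that by (simp add: M_def)
    show "\<bar>rnd (sqrt y) - x\<bar> < 2 powi e"
      using rnd_nearest[OF assms(1), of "sqrt y"] that(1) unfolding c_def by linarith
  qed
  show ?thesis
  proof (cases "(real_of_int m)\<^sup>2 < 2 * M\<^sup>2")
    case True
    define E where "E = 2 * e + (int p - 1)"
    have E: "2 powi E = M * c\<^sup>2"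
      unfolding E_def M_def c_def two_powi_add two_powi_double by simp
    have "x\<^sup>2 < 2 * (M\<^sup>2 * c\<^sup>2)"
      using mult_strict_right_mono[OF True, of "c\<^sup>2"] c by (simp add: x2)
    also have "\<dots> = 2 powi (2 * e + 2 * (int p - 1) + 1)"
      unfolding Mc two_powi_add[of _ 1] by simp
    finally have "2 powi (1 - int emax) < (2::real) powi (2 * e + 2 * (int p - 1) + 1)"
      using sq by (simp add: min_normal_def)
    then have E1: "1 - int emax - (int p - 1) \<le> E"
      by (drule_tac two_powi_less_cancel) (simp add: E_def)
    have "M\<^sup>2 * c\<^sup>2 \<le> x\<^sup>2" unfolding x2 using M2 by (intro mult_right_mono) auto
    then have "(2::real) powi (2 * e + 2 * (int p - 1)) < 2 powi (int emax + 1)"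
      using sq top by (simp add: Mc)
    then have E2: "E \<le> int emax - (int p - 1)"
      by (drule_tac two_powi_less_cancel) (simp add: E_def)
    show ?thesis
    proof (cases "real_of_int m = M")
      case True
      have "x\<^sup>2 = real_of_int m * 2 powi E"
        unfolding x2 E True by (simp add: power2_eq_square)
      moreover have "0 \<le> m" using mM M by simp
      moreover have "m < 2 ^ p" using m(2) unfolding real_less_two_power_iff .
      then have "\<bar>m\<bar> < 2 ^ p" using \<open>0 \<le> m\<close> by simp
      ultimately have "x\<^sup>2 \<in> F" using representableI E1 E2 by metis
      then show ?thesis using assms by (simp add: rnd_representable)
    next
      case False
      then have Mm: "M < real_of_int m" using mM by simp
      have err: "\<bar>x\<^sup>2 - y\<bar> \<le> 2 powi E / 2"
        unfolding y_def
      proof (rule half_ulp_error)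
        show "x\<^sup>2 \<le> 2 ^ p * 2 powi E"
          using \<open>x\<^sup>2 < 2 * (M\<^sup>2 * c\<^sup>2)\<close> unfolding E two_power_precision M_def[symmetric]
          by (simp add: power2_eq_square mult_ac)
      qed (use sq E1 E2 in auto)
      have "0 \<le> y"
      proof -
        have "M * c\<^sup>2 \<le> M\<^sup>2 * c\<^sup>2"
          using M by (intro mult_right_mono) (auto simp: power2_eq_square)
        moreover have "0 \<le> M * c\<^sup>2" using M by simp
        ultimately show ?thesis
          using err \<open>M\<^sup>2 * c\<^sup>2 \<le> x\<^sup>2\<close> unfolding E by linarith
      qed
      moreover have "M * c < x" using Mm c by (simp add: xc)
      moreover from calculation have "M * c < sqrt y + x"
        using real_sqrt_ge_zero[of y] by linarith
      moreover have "0 < M * c" using M c by simp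
      moreover have "\<bar>x\<^sup>2 - y\<bar> \<le> M * c * (c / 2)"
        using err by (simp add: E power2_eq_square mult_ac)
      ultimately have "\<bar>sqrt y - x\<bar> < c / 2" by (intro close)
      then show ?thesis using finish Mm by (simp add: y_def)
    qed
  next
    case False
    define E where "E = 2 * e + (int p - 1) + 1"
    have E: "2 powi E = 2 * (M * c\<^sup>2)"
      unfolding E_def M_def c_def two_powi_add two_powi_double by simp
    have "real_of_int m < 2 * M" using m by (simp add: two_power_precision M_def)
    then have "(real_of_int m)\<^sup>2 < (2 * M)\<^sup>2" using mM M by (intro power_strict_mono) auto
    then have "x\<^sup>2 < (2 * M)\<^sup>2 * c\<^sup>2"
      unfolding x2 using c by (intro mult_strict_right_mono) auto
    then have x4: "x\<^sup>2 < 4 * (M\<^sup>2 * c\<^sup>2)" by (simp add: power2_eq_square)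
    also have "\<dots> = 2 powi (2 * e + 2 * (int p - 1) + 2)"
      unfolding Mc two_powi_add[of _ 2] by (simp add: power_int_def)
    finally have "2 powi (1 - int emax) < (2::real) powi (2 * e + 2 * (int p - 1) + 2)"
      using sq by (simp add: min_normal_def)
    then have E1: "1 - int emax - (int p - 1) \<le> E"
      by (drule_tac two_powi_less_cancel) (simp add: E_def)
    have low: "2 * (M\<^sup>2 * c\<^sup>2) \<le> x\<^sup>2"
      unfolding x2 using False mult_right_mono[of "2 * M\<^sup>2" "(real_of_int m)\<^sup>2" "c\<^sup>2"] by simp
    moreover have "2 * (M\<^sup>2 * c\<^sup>2) = 2 powi (2 * e + 2 * (int p - 1) + 1)"
      unfolding Mc two_powi_add[of _ 1] by simp
    ultimately have "(2::real) powi (2 * e + 2 * (int p - 1) + 1) < 2 powi (int emax + 1)"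
      using sq top by simp
    then have E2: "E \<le> int emax - (int p - 1)"
      by (drule_tac two_powi_less_cancel) (simp add: E_def)
    have err: "\<bar>x\<^sup>2 - y\<bar> \<le> 2 powi E / 2"
      unfolding y_def
    proof (rule half_ulp_error)
      show "x\<^sup>2 \<le> 2 ^ p * 2 powi E"
        using x4 unfolding E two_power_precision M_def[symmetric]
        by (simp add: power2_eq_square mult_ac)
    qed (use sq E1 E2 in auto)
    have "M * c\<^sup>2 \<le> M\<^sup>2 * c\<^sup>2"
      using M by (intro mult_right_mono) (auto simp: power2_eq_square)
    then have ylow: "(M * c)\<^sup>2 \<le> y"
      using err low unfolding E power_mult_distrib by linarith
    then have "M * c \<le> sqrt y" using M c by (intro real_le_rsqrt)
    moreover have "0 < M\<^sup>2" using M by simp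
    then have "M\<^sup>2 < (real_of_int m)\<^sup>2"
      using False by linarith
    then have Mm: "M < real_of_int m" using mM by (cases "real_of_int m = M") auto
    then have "M * c < x" using c by (simp add: xc)
    ultimately have "2 * (M * c) < sqrt y + x" by linarith
    moreover have "0 \<le> y" using ylow by (rule order_trans[rotated]) simp
    moreover have "0 < 2 * (M * c)" using M c by simp
    moreover have "\<bar>x\<^sup>2 - y\<bar> \<le> 2 * (M * c) * (c / 2)"
      using err by (simp add: E power2_eq_square mult_ac)
    ultimately have "\<bar>sqrt y - x\<bar> < c / 2" by (intro close)
    then show ?thesis using finish Mm by (simp add: y_def)
  qed
qed

end

section \<open>Operations on vectors with representable results\<close>

context rounding_format
begin

lemma fp_mult_representable: "a * b \<in> F \<Longrightarrow> fp_mult f (Some a) (Some b) = Some (a * b)"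
  by (simp add: fp_mult_def fl_representable)

text \<open>
  Zero summands leave partial sums unchanged, so with one other summand no order or
  bracketing incurs a rounding error.
\<close>

lemma fp_sum_single_summand:
  assumes "fp_sum f X x" "c \<in> F"
    and "set_mset X \<subseteq> {Some 0, Some c}" "c = 0 \<or> count X (Some c) \<le> 1"
  shows "x = (if Some c \<in># X then Some c else Some 0)"
  using assms(1,3,4)
proof induction
  case (single x)
  then show ?case by auto
next
  case (add X x Y y)
  then have x: "x = (if Some c \<in># X then Some c else Some 0)"
    and y: "y = (if Some c \<in># Y then Some c else Some 0)"
    by auto
  have "c = 0 \<or> Some c \<notin># X \<or> Some c \<notin># Y"
    using add(6) by (auto simp flip: count_greater_zero_iff)
  then show ?case
    using assms(2) by (auto simp: x y fp_add_def fl_representable)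
qed

text \<open>
  The remaining product \<open>c\<close> is the rounded one: the statement also serves for the squared norm, where
  this product is inexact in general.
\<close>

lemma fp_inner_single_product:
  assumes k: "k < dim_vec y"
    and one: "fp_mult f (x $ k) (y $ k) = Some c" "c \<in> F"
    and others: "\<And>i. i < dim_vec y \<Longrightarrow> i \<noteq> k \<Longrightarrow> fp_mult f (x $ i) (y $ i) = Some 0"
  shows "fp_inner f sm x y = Some c"
proof -
  define g where "g = (\<lambda>i. fp_mult f (x $ i) (y $ i))"
  have "[0..<dim_vec y] = [0..<k] @ k # [Suc k..<dim_vec y]"
    using k upt_add_eq_append[of 0 k "dim_vec y - k"] by (simp add: upt_conv_Cons)
  then have split: "map g [0..<dim_vec y] = map g [0..<k] @ Some c # map g [Suc k..<dim_vec y]"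
    using one by (simp add: g_def)
  have zeros: "g ` {0..<k} \<subseteq> {Some 0}" "g ` {Suc k..<dim_vec y} \<subseteq> {Some 0}"
    using others k by (auto simp: g_def)
  have sum: "fp_sum f (mset (map g [0..<dim_vec y])) (sm (map g [0..<dim_vec y]))"
  proof -
    have "map g [0..<dim_vec y] \<noteq> []" using k by simp
    then show ?thesis using summation unfolding summation_algorithm_def by blast
  qed
  have count: "c = 0 \<or> count (mset (map g [0..<dim_vec y])) (Some c) \<le> 1"
  proof (cases "c = 0")
    case False
    then have "Some c \<notin> g ` {0..<k}" "Some c \<notin> g ` {Suc k..<dim_vec y}"
      using zeros by auto
    then have "count (mset (map g [0..<k])) (Some c) = 0"
      "count (mset (map g [Suc k..<dim_vec y])) (Some c) = 0"
      by (auto simp only: count_eq_zero_iff set_mset_mset set_map set_upt)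
    then show ?thesis unfolding split by simp
  qed simp
  have summands: "set_mset (mset (map g [0..<dim_vec y])) \<subseteq> {Some 0, Some c}"
    unfolding split using zeros by auto
  have "Some c \<in># mset (map g [0..<dim_vec y])"
    unfolding split by simp
  then have "sm (map g [0..<dim_vec y]) = Some c"
    using fp_sum_single_summand[OF sum one(2) summands count] by (simp only: if_True)
  then show ?thesis by (simp add: fp_inner_def g_def)
qed

text \<open>
  A vector with one nonzero entry turns every row's inner product into a single product, which
  equals the exact result. Representability is therefore needed of the result alone.
\<close>

lemma fp_matvec_representable:
  assumes A: "A \<in> carrier_mat m n" and x: "x \<in> carrier_vec n"
    and k: "k < n" "\<And>i. i < n \<Longrightarrow> i \<noteq> k \<Longrightarrow> x $ i = 0"
    and rep: "\<And>i. i < m \<Longrightarrow> (A *\<^sub>v x) $ i \<in> F"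
  shows "matvec (fp_arith f sm) (map_mat Some A) (map_vec Some x) = map_vec Some (A *\<^sub>v x)"
proof (rule eq_vecI)
  fix i assume "i < dim_vec (map_vec Some (A *\<^sub>v x))"
  then have i: "i < m" using A by simp
  have Ax: "(A *\<^sub>v x) $ i = A $$ (i, k) * x $ k"
  proof -
    have "(A *\<^sub>v x) $ i = (\<Sum>l = 0..<n. A $$ (i, l) * x $ l)"
      using A x i by (auto simp: scalar_prod_def intro!: sum.cong)
    also have "\<dots> = (\<Sum>l = 0..<n. if l = k then A $$ (i, k) * x $ k else 0)"
      using k by (intro sum.cong) auto
    finally show ?thesis using k by simp
  qed
  have "fp_inner f sm (row (map_mat Some A) i) (map_vec Some x) = Some ((A *\<^sub>v x) $ i)"
  proof (rule fp_inner_single_product)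
    show "fp_mult f (row (map_mat Some A) i $ k) (map_vec Some x $ k) = Some ((A *\<^sub>v x) $ i)"
      using A x i k rep[OF i] by (simp add: Ax fp_mult_representable del: index_mult_mat_vec)
  qed (use A x i k rep in \<open>auto simp: fp_mult_representable simp del: index_mult_mat_vec\<close>)
  then show "matvec (fp_arith f sm) (map_mat Some A) (map_vec Some x) $ i = map_vec Some (A *\<^sub>v x) $ i"
    using A i by (simp add: fp_arith_def)
qed (use A in \<open>simp add: fp_arith_def\<close>)

lemma fp_vscale_representable:
  "(\<And>i. i < dim_vec x \<Longrightarrow> c * x $ i \<in> F) \<Longrightarrow>
    vscale (fp_arith f sm) (Some c) (map_vec Some x) = map_vec Some (c \<cdot>\<^sub>v x)"
  by (intro eq_vecI) (auto simp: fp_arith_def fp_mult_representable)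

lemma fp_vsub_representable:
  "dim_vec x = dim_vec y \<Longrightarrow> (\<And>i. i < dim_vec y \<Longrightarrow> x $ i - y $ i \<in> F) \<Longrightarrow>
    vsub (fp_arith f sm) (map_vec Some x) (map_vec Some y) = map_vec Some (x - y)"
  by (intro eq_vecI) (auto simp: fp_arith_def fp_sub_def fl_representable)

end

section \<open>Signed coordinate vectors\<close>

definition signed_coordinate_vec :: "nat \<Rightarrow> nat \<Rightarrow> real vec \<Rightarrow> bool" where
  "signed_coordinate_vec n k q \<longleftrightarrow> k < n \<and> q \<in> carrier_vec n \<and> q $ k \<in> {1, - 1} \<and>
     (\<forall>i < n. i \<noteq> k \<longrightarrow> q $ i = 0)"

lemma signed_coordinate_vec_entry:
  "signed_coordinate_vec n k q \<Longrightarrow> i < n \<Longrightarrow> q $ i = (if i = k then q $ k else 0)"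
  by (auto simp: signed_coordinate_vec_def)

lemma signed_coordinate_vec_inner:
  assumes "signed_coordinate_vec n k q"
  shows "(c \<cdot>\<^sub>v q) \<bullet> (c \<cdot>\<^sub>v q) = c\<^sup>2"
proof -
  have "(c \<cdot>\<^sub>v q) \<bullet> (c \<cdot>\<^sub>v q) = (\<Sum>i = 0..<n. if i = k then c\<^sup>2 else 0)"
    using assms unfolding scalar_prod_def
    by (intro sum.cong) (auto simp: signed_coordinate_vec_def power2_eq_square)
  also have "\<dots> = c\<^sup>2" using assms by (simp add: signed_coordinate_vec_def)
  finally show ?thesis .
qed

lemma exact_normalize_line:
  assumes q: "signed_coordinate_vec n k q" and "0 \<le> c"
  shows "normalize_line exact_arith (c \<cdot>\<^sub>v q) = GK_Line (c \<cdot>\<^sub>v q) c (if c = 0 then None else Some q)"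
proof -
  have "vnorm exact_arith (c \<cdot>\<^sub>v q) = c"
    unfolding exact_arith_def vec_arith.simps signed_coordinate_vec_inner[OF q]
    using \<open>0 \<le> c\<close> by simp
  moreover have "vdiv exact_arith (c \<cdot>\<^sub>v q) c = q" if "c \<noteq> 0"
    using that by (auto simp: exact_arith_def)
  ultimately show ?thesis
    by (auto simp: normalize_line_def exact_arith_def)
qed

context rounding_format
begin

lemma scaled_signed_coordinate_vec_representable:
  "signed_coordinate_vec n k q \<Longrightarrow> c \<in> F \<Longrightarrow> i < n \<Longrightarrow> c * q $ i \<in> F"
  by (cases "i = k") (auto simp: signed_coordinate_vec_def uminus_representable)

text \<open>
  Squaring the entry \<open>\<plusminus>c\<close> may round, but taking the square root undoes this.
\<close>

lemma fp_vnorm_signed_coordinate_vec: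
  assumes q: "signed_coordinate_vec n k q" and c: "c \<in> F"
    and range: "c = 0 \<or> 0 < c \<and> within_exponent_range p emax (c\<^sup>2)"
  shows "vnorm (fp_arith f sm) (map_vec Some (c \<cdot>\<^sub>v q)) = Some c"
proof -
  define y where "y = rnd (c\<^sup>2)"
  have sq: "0 \<le> c\<^sup>2" "c\<^sup>2 \<le> max_finite p emax"
    using range one_le_max_finite by (auto simp: within_exponent_range_def)
  have k: "k < n" "dim_vec q = n" using q by (auto simp: signed_coordinate_vec_def)
  have "fp_inner f sm (map_vec Some (c \<cdot>\<^sub>v q)) (map_vec Some (c \<cdot>\<^sub>v q)) = Some y"
  proof (rule fp_inner_single_product)
    show "y \<in> F" by (simp add: y_def rnd_is_representable)
    have "(c * q $ k) * (c * q $ k) = c\<^sup>2"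
      using q by (auto simp: signed_coordinate_vec_def power2_eq_square)
    then show "fp_mult f (map_vec Some (c \<cdot>\<^sub>v q) $ k) (map_vec Some (c \<cdot>\<^sub>v q) $ k) = Some y"
      using k sq by (simp add: fp_mult_def y_def fl_no_overflow)
  qed (use q k in \<open>auto simp: signed_coordinate_vec_def fp_mult_def fl_representable\<close>)
  moreover have "fp_sqrt f (Some y) = Some c"
  proof (cases "c = 0")
    case True
    then show ?thesis by (simp add: y_def rnd_representable fp_sqrt_def fl_representable)
  next
    case False
    have y0: "0 \<le> y"
      using rnd_nearest[OF zero_representable, of "c\<^sup>2"] sq unfolding y_def by (smt (verit))
    have "y \<le> max_finite p emax"
      using representable_abs_le_max_finite[OF rnd_is_representable, of "c\<^sup>2"] by (simp add: y_def)
    moreover have "sqrt y \<le> 1 \<or> sqrt y \<le> y"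
    proof (cases "y \<le> 1")
      case False
      then have "y \<le> y\<^sup>2" by (simp add: power2_eq_square)
      then have "sqrt y \<le> y" using False by (intro real_le_lsqrt) auto
      then show ?thesis by simp
    qed simp
    ultimately have "sqrt y \<le> max_finite p emax"
      using one_le_max_finite by linarith
    then have "f (sqrt y) = Some (rnd (sqrt y))"
      using y0 by (intro fl_no_overflow) simp
    then show ?thesis
      using False range c y0 by (simp add: fp_sqrt_def sqrt_of_rounded_square y_def)
  qed
  ultimately show ?thesis by (simp add: fp_arith_def)
qed

lemma fp_normalize_line:
  assumes q: "signed_coordinate_vec n k q" "\<And>i. i < n \<Longrightarrow> q $ i \<in> F" and c: "c \<in> F"
    and range: "c = 0 \<or> 0 < c \<and> within_exponent_range p emax (c\<^sup>2)"
  shows "normalize_line (fp_arith f sm) (map_vec Some (c \<cdot>\<^sub>v q)) =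
    line_some (normalize_line exact_arith (c \<cdot>\<^sub>v q))"
proof -
  have n: "dim_vec q = n" using q by (auto simp: signed_coordinate_vec_def)
  have div: "vdiv (fp_arith f sm) (map_vec Some (c \<cdot>\<^sub>v q)) (Some c) = map_vec Some q" if "c \<noteq> 0"
    using that q(2) n by (intro eq_vecI) (auto simp: fp_arith_def fp_div_def fl_representable)
  have "0 \<le> c" using range by auto
  then show ?thesis
    unfolding exact_normalize_line[OF q(1) \<open>0 \<le> c\<close>]
    using div
    by (auto simp: normalize_line_def fp_vnorm_signed_coordinate_vec[OF q(1) c range] line_some_def
        Let_def) (auto simp: fp_arith_def)
qed

end

section \<open>Running the algorithm\<close>

text \<open>
  This is the run of the loop in an arbitrary arithmetic, once the outcome of every line is known. It is
  indexed so that \<open>c i\<close>, \<open>d i\<close>, \<open>q i\<close> stand for \<open>\<gamma>\<^sub>i\<^sub>+\<^sub>1\<close>, \<open>\<delta>\<^sub>i\<^sub>+\<^sub>1\<close> and the common value of \<open>s\<^sub>i\<^sub>+\<^sub>1\<close> and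
  \<open>w\<^sub>i\<^sub>+\<^sub>1\<close>; the vector \<open>w\<^sub>0\<close> that precedes \<open>q 0\<close> is passed separately.
\<close>

lemma gk_loop_lines:
  assumes G: "\<And>i. i < n \<Longrightarrow> normalize_line R (vsub R (matvec R (transpose_mat B) (q i))
      (vscale R (d i) (case i of 0 \<Rightarrow> w0 | Suc j \<Rightarrow> q j))) = GK_Line (u i) (c i) (Some (q i))"
    and H: "\<And>i. Suc i < n \<Longrightarrow> normalize_line R (vsub R (matvec R B (q i)) (vscale R (c i) (q i))) =
      GK_Line (t (Suc i)) (d (Suc i)) (Some (q (Suc i)))"
    and Z: "normalize_line R (vsub R (matvec R B (q (n - 1))) (vscale R (c (n - 1)) (q (n - 1)))) =
      GK_Line z e None"
    and "i < n"
  shows "gk_loop R B (n - i) (d i) (q i) (case i of 0 \<Rightarrow> w0 | Suc j \<Rightarrow> q j) =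
    (map (\<lambda>j. GK_Line (t j) (d j) (Some (q j))) [Suc i..<n] @ [GK_Line z e None],
     map (\<lambda>j. GK_Line (u j) (c j) (Some (q j))) [i..<n])"
  using \<open>i < n\<close>
proof (induction "n - Suc i" arbitrary: i)
  case 0
  then have i: "n - i = Suc 0" "i = n - 1" by auto
  show ?case
    unfolding i(1) using G[OF \<open>i < n\<close>] Z 0(2) unfolding i(2)[symmetric]
    using 0(1) by (simp add: Let_def upt_conv_Cons)
next
  case (Suc k)
  then have i: "n - i = Suc (n - Suc i)" "Suc i < n" by auto
  have IH: "gk_loop R B (n - Suc i) (d (Suc i)) (q (Suc i)) (q i) =
    (map (\<lambda>j. GK_Line (t j) (d j) (Some (q j))) [Suc (Suc i)..<n] @ [GK_Line z e None],
     map (\<lambda>j. GK_Line (u j) (c j) (Some (q j))) [Suc i..<n])"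
    using Suc.hyps(1)[of "Suc i"] Suc.hyps(2) i by simp
  show ?case
    unfolding i(1) using G[OF \<open>i < n\<close>] H[OF i(2)] IH i
    by (simp add: Let_def upt_conv_Cons)
qed

lemma golub_kahan_lines:
  assumes G: "\<And>i. i < n \<Longrightarrow> normalize_line R (vsub R (matvec R (transpose_mat B) (q i))
      (vscale R (d i) (case i of 0 \<Rightarrow> vec n (\<lambda>_. azero R) | Suc j \<Rightarrow> q j))) =
      GK_Line (u i) (c i) (Some (q i))"
    and H: "\<And>i. Suc i < n \<Longrightarrow> normalize_line R (vsub R (matvec R B (q i)) (vscale R (c i) (q i))) =
      GK_Line (t (Suc i)) (d (Suc i)) (Some (q (Suc i)))"
    and Z: "normalize_line R (vsub R (matvec R B (q (n - 1))) (vscale R (c (n - 1)) (q (n - 1)))) =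
      GK_Line z e None"
    and B: "B \<in> carrier_mat n n" and "0 < n"
    and b: "normalize_line R b = GK_Line (t 0) (d 0) (Some (q 0))"
  shows "golub_kahan R B b =
    (map (\<lambda>j. GK_Line (t j) (d j) (Some (q j))) [0..<n] @ [GK_Line z e None],
     map (\<lambda>j. GK_Line (u j) (c j) (Some (q j))) [0..<n])"
proof -
  have "dim_row B = n" "dim_col B = n" using B by auto
  moreover have "[0..<n] = 0 # [Suc 0..<n]" using \<open>0 < n\<close> by (rule upt_conv_Cons)
  ultimately show ?thesis
    using gk_loop_lines[OF G H Z \<open>0 < n\<close>] b
    by (simp add: golub_kahan_def Let_def)
qed

context rounding_format
begin

text \<open>
  With disjoint supports, each entry of the product is an entry of one of the two terms and hence
  representable. The subtraction meets either equal numbers or a zero, and is exact too.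
\<close>

lemma residual_of_two_term_product:
  assumes B: "B \<in> carrier_mat n n" and x: "signed_coordinate_vec n k x"
    and y: "y \<in> carrier_vec n" and w: "w \<in> carrier_vec n"
    and product: "B *\<^sub>v x = a \<cdot>\<^sub>v y + d \<cdot>\<^sub>v w"
    and disjoint: "\<And>r. r < n \<Longrightarrow> y $ r = 0 \<or> w $ r = 0"
    and rep: "\<And>r. r < n \<Longrightarrow> a * y $ r \<in> F" "\<And>r. r < n \<Longrightarrow> d * w $ r \<in> F"
  shows "vsub exact_arith (matvec exact_arith B x) (vscale exact_arith d w) = a \<cdot>\<^sub>v y"
    and "vsub (fp_arith f sm) (matvec (fp_arith f sm) (map_mat Some B) (map_vec Some x))
        (vscale (fp_arith f sm) (Some d) (map_vec Some w)) = map_vec Some (a \<cdot>\<^sub>v y)"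
proof -
  have dims: "dim_vec y = n" "dim_vec w = n" using y w by auto
  have diff: "B *\<^sub>v x - d \<cdot>\<^sub>v w = a \<cdot>\<^sub>v y"
    unfolding product using dims by (intro eq_vecI) auto
  then show "vsub exact_arith (matvec exact_arith B x) (vscale exact_arith d w) = a \<cdot>\<^sub>v y"
    by (simp add: exact_arith_def)
  have "(B *\<^sub>v x) $ r \<in> F" if "r < n" for r
    unfolding product using disjoint[OF that] rep[OF that] dims that by auto
  then have "matvec (fp_arith f sm) (map_mat Some B) (map_vec Some x) = map_vec Some (B *\<^sub>v x)"
    using x by (intro fp_matvec_representable[OF B, where k = k]) (auto simp: signed_coordinate_vec_def)
  moreover have "vscale (fp_arith f sm) (Some d) (map_vec Some w) = map_vec Some (d \<cdot>\<^sub>v w)"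
    using rep dims by (intro fp_vscale_representable) auto
  moreover have "vsub (fp_arith f sm) (map_vec Some (B *\<^sub>v x)) (map_vec Some (d \<cdot>\<^sub>v w)) =
      map_vec Some (B *\<^sub>v x - d \<cdot>\<^sub>v w)"
  proof (rule fp_vsub_representable)
    show "dim_vec (B *\<^sub>v x) = dim_vec (d \<cdot>\<^sub>v w)" using B dims by simp
    fix r assume "r < dim_vec (d \<cdot>\<^sub>v w)"
    then have "r < n" using dims by simp
    have "(B *\<^sub>v x) $ r - (d \<cdot>\<^sub>v w) $ r = (B *\<^sub>v x - d \<cdot>\<^sub>v w) $ r"
      using \<open>r < n\<close> dims by simp
    also have "\<dots> = a * y $ r" unfolding diff using \<open>r < n\<close> dims by simp
    finally show "(B *\<^sub>v x) $ r - (d \<cdot>\<^sub>v w) $ r \<in> F" using rep(1)[OF \<open>r < n\<close>] by metis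
  qed
  ultimately show "vsub (fp_arith f sm) (matvec (fp_arith f sm) (map_mat Some B) (map_vec Some x))
      (vscale (fp_arith f sm) (Some d) (map_vec Some w)) = map_vec Some (a \<cdot>\<^sub>v y)"
    by (simp add: diff)
qed

text \<open>
  The recurrences say that \<open>q 0\<close>, \<open>q 1\<close>, ... serve as both the left and the right vectors of the
  bidiagonalization. Since they are signed coordinate vectors for different coordinates, every
  right-hand side vector is an exactly computed multiple of one of them, and normalizing it
  recovers both the factor and the vector without error. The last right-hand side vector cancels to
  exactly zero, so both runs stop there.
\<close>

lemma golub_kahan_signed_coordinate_vecs:
  assumes "0 < n" and B: "B \<in> carrier_mat n n"
    and q: "\<And>i. i < n \<Longrightarrow> signed_coordinate_vec n (k i) (q i)" and k: "inj_on k {..<n}"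
    and q_entries: "\<And>i r. i < n \<Longrightarrow> r < n \<Longrightarrow> q i $ r \<in> F"
    and c: "\<And>i. i < n \<Longrightarrow> c i \<in> F \<and> 0 < c i \<and> within_exponent_range p emax ((c i)\<^sup>2)"
    and d: "\<And>i. i < n \<Longrightarrow> d i \<in> F \<and> 0 < d i \<and> within_exponent_range p emax ((d i)\<^sup>2)"
    and transposed_product: "\<And>i. i < n \<Longrightarrow> transpose_mat B *\<^sub>v q i =
      c i \<cdot>\<^sub>v q i + d i \<cdot>\<^sub>v (case i of 0 \<Rightarrow> 0\<^sub>v n | Suc j \<Rightarrow> q j)"
    and product: "\<And>i. Suc i < n \<Longrightarrow> B *\<^sub>v q i = d (Suc i) \<cdot>\<^sub>v q (Suc i) + c i \<cdot>\<^sub>v q i"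
    and last_product: "B *\<^sub>v q (n - 1) = c (n - 1) \<cdot>\<^sub>v q (n - 1)"
  defines "lines \<equiv>
    (map (\<lambda>i. GK_Line (d i \<cdot>\<^sub>v q i) (d i) (Some (q i))) [0..<n] @ [GK_Line (0\<^sub>v n) 0 None],
     map (\<lambda>i. GK_Line (c i \<cdot>\<^sub>v q i) (c i) (Some (q i))) [0..<n])"
  shows "golub_kahan exact_arith B (d 0 \<cdot>\<^sub>v q 0) = lines"
    and "golub_kahan (fp_arith f sm) (map_mat Some B) (map_vec Some (d 0 \<cdot>\<^sub>v q 0)) =
      map_prod (map line_some) (map line_some) lines"
proof -
  let ?R = "fp_arith f sm"
  define w where "w = (\<lambda>i. case i of 0 \<Rightarrow> 0\<^sub>v n | Suc j \<Rightarrow> q j)"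
  have qc: "q i \<in> carrier_vec n" if "i < n" for i
    using q[OF that] by (simp add: signed_coordinate_vec_def)
  have wc: "w i \<in> carrier_vec n" if "i < n" for i
    using that qc by (cases i) (auto simp: w_def)
  have disjoint: "q i $ r = 0 \<or> q j $ r = 0" if "i < n" "j < n" "i \<noteq> j" "r < n" for i j r
    using that k q[of i] q[of j] by (auto simp: signed_coordinate_vec_def inj_on_def)
  have scaled: "a * q i $ r \<in> F" if "a \<in> F" "i < n" "r < n" for a i r
    using scaled_signed_coordinate_vec_representable[OF q] that by blast
  have line: "normalize_line exact_arith (a \<cdot>\<^sub>v q i) = GK_Line (a \<cdot>\<^sub>v q i) a (Some (q i))"
    "normalize_line ?R (map_vec Some (a \<cdot>\<^sub>v q i)) =
      GK_Line (map_vec Some (a \<cdot>\<^sub>v q i)) (Some a) (Some (map_vec Some (q i)))"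
    if "i < n" "a \<in> F \<and> 0 < a \<and> within_exponent_range p emax (a\<^sup>2)" for i a
    using that exact_normalize_line[OF q[OF that(1)], of a] 
      fp_normalize_line[OF q[OF that(1)] q_entries[OF that(1)], of a]
    by (auto simp: line_some_def)
  have zero_line: "normalize_line exact_arith (0\<^sub>v n) = GK_Line (0\<^sub>v n) 0 None"
    "normalize_line ?R (map_vec Some (0\<^sub>v n)) = GK_Line (map_vec Some (0\<^sub>v n)) (Some 0) None"
  proof -
    \<comment> \<open>The zero vector is a multiple of a signed coordinate vector with factor 0.\<close>
    have "0 \<cdot>\<^sub>v q 0 = 0\<^sub>v n" using qc[OF \<open>0 < n\<close>] by (intro eq_vecI) auto
    then show "normalize_line exact_arith (0\<^sub>v n) = GK_Line (0\<^sub>v n) 0 None"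
      "normalize_line ?R (map_vec Some (0\<^sub>v n)) = GK_Line (map_vec Some (0\<^sub>v n)) (Some 0) None"
      using exact_normalize_line[OF q[OF \<open>0 < n\<close>], of 0]
        fp_normalize_line[OF q[OF \<open>0 < n\<close>] q_entries[OF \<open>0 < n\<close>], of 0]
      by (auto simp: line_some_def)
  qed
  have wdisj: "q i $ r = 0 \<or> w i $ r = 0" if "i < n" "r < n" for i r
    using that disjoint by (cases i) (auto simp: w_def)
  have wscaled: "d i * w i $ r \<in> F" if "i < n" "r < n" for i r
    using that scaled d by (cases i) (auto simp: w_def)
  have G: "vsub exact_arith (matvec exact_arith (transpose_mat B) (q i))
        (vscale exact_arith (d i) (w i)) = c i \<cdot>\<^sub>v q i"
      "vsub ?R (matvec ?R (map_mat Some (transpose_mat B)) (map_vec Some (q i)))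
        (vscale ?R (Some (d i)) (map_vec Some (w i))) = map_vec Some (c i \<cdot>\<^sub>v q i)"
    if i: "i < n" for i
    using residual_of_two_term_product[OF _ q[OF i] qc[OF i] wc[OF i] _ wdisj[OF i]]
      transposed_product[OF i] B scaled c[OF i] wscaled[OF i] i by (auto simp: w_def)
  have H: "vsub exact_arith (matvec exact_arith B (q i)) (vscale exact_arith (c i) (q i)) =
        d (Suc i) \<cdot>\<^sub>v q (Suc i)"
      "vsub ?R (matvec ?R (map_mat Some B) (map_vec Some (q i)))
        (vscale ?R (Some (c i)) (map_vec Some (q i))) = map_vec Some (d (Suc i) \<cdot>\<^sub>v q (Suc i))"
    if i: "Suc i < n" for i
    using residual_of_two_term_product[OF B q[OF Suc_lessD[OF i]] qc[OF i] qc[OF Suc_lessD[OF i]]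
        product[OF i] disjoint[OF i Suc_lessD[OF i]]]
      scaled c[OF Suc_lessD[OF i]] d[OF i] i by auto
  have last: "n - 1 < n" using \<open>0 < n\<close> by simp
  have Z: "vsub exact_arith (matvec exact_arith B (q (n - 1)))
        (vscale exact_arith (c (n - 1)) (q (n - 1))) = 0\<^sub>v n"
      "vsub ?R (matvec ?R (map_mat Some B) (map_vec Some (q (n - 1))))
        (vscale ?R (Some (c (n - 1))) (map_vec Some (q (n - 1)))) = map_vec Some (0\<^sub>v n)"
  proof -
    have "B *\<^sub>v q (n - 1) = 0 \<cdot>\<^sub>v 0\<^sub>v n + c (n - 1) \<cdot>\<^sub>v q (n - 1)"
      using last_product qc[OF last] by (intro eq_vecI) auto
    note * = residual_of_two_term_product[OF B q[OF last] zero_carrier_vec qc[OF last] this]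
    show "vsub exact_arith (matvec exact_arith B (q (n - 1)))
        (vscale exact_arith (c (n - 1)) (q (n - 1))) = 0\<^sub>v n"
      "vsub ?R (matvec ?R (map_mat Some B) (map_vec Some (q (n - 1))))
        (vscale ?R (Some (c (n - 1))) (map_vec Some (q (n - 1)))) = map_vec Some (0\<^sub>v n)"
      using * scaled c last by auto
  qed
  have w0: "vec n (\<lambda>_. azero exact_arith) = 0\<^sub>v n"
      "vec n (\<lambda>_. azero ?R) = map_vec Some (0\<^sub>v n)"
    by (auto simp: exact_arith_def fp_arith_def)
  have wcase: "(case i of 0 \<Rightarrow> 0\<^sub>v n | Suc j \<Rightarrow> q j) = w i"
    "(case i of 0 \<Rightarrow> map_vec Some (0\<^sub>v n) | Suc j \<Rightarrow> map_vec Some (q j)) = map_vec Some (w i)" for i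
    by (auto simp: w_def split: nat.splits)
  show "golub_kahan exact_arith B (d 0 \<cdot>\<^sub>v q 0) = lines"
    unfolding lines_def
    by (rule golub_kahan_lines[OF _ _ _ B \<open>0 < n\<close>])
      (simp_all only: w0 wcase G H Z zero_line line c d \<open>0 < n\<close> Suc_lessD)
  have "golub_kahan ?R (map_mat Some B) (map_vec Some (d 0 \<cdot>\<^sub>v q 0)) =
    (map (\<lambda>i. GK_Line (map_vec Some (d i \<cdot>\<^sub>v q i)) (Some (d i)) (Some (map_vec Some (q i)))) [0..<n]
       @ [GK_Line (map_vec Some (0\<^sub>v n)) (Some 0) None],
     map (\<lambda>i. GK_Line (map_vec Some (c i \<cdot>\<^sub>v q i)) (Some (c i)) (Some (map_vec Some (q i)))) [0..<n])"
    by (rule golub_kahan_lines[OF _ _ _ _ \<open>0 < n\<close>])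
      (simp_all only: w0 wcase map_mat_transpose G H Z zero_line line c d \<open>0 < n\<close> Suc_lessD
        map_carrier_mat B)
  then show "golub_kahan ?R (map_mat Some B) (map_vec Some (d 0 \<cdot>\<^sub>v q 0)) =
      map_prod (map line_some) (map line_some) lines"
    by (simp add: lines_def line_some_def)
qed

end

section \<open>Signed permutations of bidiagonal matrices\<close>

lemma mult_mat_unit_vec: "A \<in> carrier_mat m n \<Longrightarrow> j < n \<Longrightarrow> (A :: real mat) *\<^sub>v unit_vec n j = col A j"
  by (intro eq_vecI) auto

lemma signed_permutation_mat_columns:
  assumes "signed_permutation_mat n P"
  obtains \<pi> where "inj_on \<pi> {..<n}" "\<And>j. j < n \<Longrightarrow> signed_coordinate_vec n (\<pi> j) (col P j)"
proof -
  have P: "P \<in> carrier_mat n n" using assms by (simp add: signed_permutation_mat_def)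
  obtain Q where "permutation_mat n Q"
    and PQ: "\<forall>i < n. \<forall>j < n.
      if Q $$ (i, j) = 1 then P $$ (i, j) \<in> {1, - 1} else P $$ (i, j) = 0"
    using assms unfolding signed_permutation_mat_def by meson
  then obtain \<pi> where \<pi>: "\<pi> permutes {..<n}"
    and Q: "Q = mat n n (\<lambda>(i, j). if i = \<pi> j then 1 else 0)"
    unfolding permutation_mat_def by (elim exE conjE) (rule that)
  have "signed_coordinate_vec n (\<pi> j) (col P j)" if "j < n" for j
  proof -
    have "\<pi> j < n" using permutes_in_image[OF \<pi>, of j] that by simp
    moreover have "P $$ (\<pi> j, j) \<in> {1, - 1}"
      using PQ[rule_format, OF \<open>\<pi> j < n\<close> \<open>j < n\<close>] \<open>\<pi> j < n\<close> \<open>j < n\<close> by (simp add: Q)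
    moreover have "P $$ (i, j) = 0" if "i < n" "i \<noteq> \<pi> j" for i
      using PQ[rule_format, OF \<open>i < n\<close> \<open>j < n\<close>] that \<open>j < n\<close> by (simp add: Q)
    ultimately show ?thesis
      using P \<open>j < n\<close> by (auto simp: signed_coordinate_vec_def)
  qed
  then show thesis using that permutes_inj_on[OF \<pi>] by blast
qed

lemma signed_permutation_mat_orthogonal:
  assumes "signed_permutation_mat n P"
  shows "transpose_mat P * P = 1\<^sub>m n"
proof -
  have P: "P \<in> carrier_mat n n" using assms by (simp add: signed_permutation_mat_def)
  obtain \<pi> where \<pi>: "inj_on \<pi> {..<n}"
    and cols: "\<And>j. j < n \<Longrightarrow> signed_coordinate_vec n (\<pi> j) (col P j)"
    using signed_permutation_mat_columns[OF assms] by blast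
  have "col P i \<bullet> col P j = (if i = j then 1 else 0)" if "i < n" "j < n" for i j
  proof (cases "i = j")
    case True
    then show ?thesis using signed_coordinate_vec_inner[OF cols[OF that(1)], of 1] by simp
  next
    case False
    then have "\<pi> i \<noteq> \<pi> j" using \<pi> that by (auto simp: inj_on_def)
    then have "col P i $ r * col P j $ r = 0" if "r < n" for r
      using cols[OF \<open>i < n\<close>] cols[OF \<open>j < n\<close>] that unfolding signed_coordinate_vec_def
      by (metis mult_zero_left mult_zero_right)
    then show ?thesis using False P by (auto simp: scalar_prod_def intro!: sum.neutral)
  qed
  then show ?thesis using P by (intro eq_matI) auto
qed

lemma conjugate_mult_mat_vec:
  fixes P X :: "real mat"
  assumes "P \<in> carrier_mat n n" "X \<in> carrier_mat n n" "transpose_mat P * P = 1\<^sub>m n" "x \<in> carrier_vec n"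
  shows "(P * X * transpose_mat P) *\<^sub>v (P *\<^sub>v x) = P *\<^sub>v (X *\<^sub>v x)"
proof -
  have T: "transpose_mat P \<in> carrier_mat n n" and Px: "P *\<^sub>v x \<in> carrier_vec n"
    using assms by auto
  have "(P * X * transpose_mat P) *\<^sub>v (P *\<^sub>v x) = (P * X) *\<^sub>v (transpose_mat P *\<^sub>v (P *\<^sub>v x))"
    using assms T Px by (intro assoc_mult_mat_vec) auto
  also have "transpose_mat P *\<^sub>v (P *\<^sub>v x) = x"
    using assms assoc_mult_mat_vec[OF T assms(1,4)] by simp
  also have "(P * X) *\<^sub>v x = P *\<^sub>v (X *\<^sub>v x)"
    using assms by (intro assoc_mult_mat_vec) auto
  finally show ?thesis .
qed

lemma lower_bidiag_mat_carrier: "lower_bidiag_mat n \<gamma> \<delta> \<in> carrier_mat n n"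
  by (simp add: lower_bidiag_mat_def)

text \<open>
  In the last column, the term with \<^term>\<open>unit_vec n n\<close> disappears, since this is the zero vector.
\<close>

lemma lower_bidiag_mat_mult_unit_vec:
  assumes "j < n"
  shows "lower_bidiag_mat n \<gamma> \<delta> *\<^sub>v unit_vec n j =
    \<delta> (Suc (Suc j)) \<cdot>\<^sub>v unit_vec n (Suc j) + \<gamma> (Suc j) \<cdot>\<^sub>v unit_vec n j"
  unfolding mult_mat_unit_vec[OF lower_bidiag_mat_carrier assms]
  using assms by (intro eq_vecI) (auto simp: lower_bidiag_mat_def unit_vec_def)

lemma transpose_lower_bidiag_mat_mult_unit_vec:
  assumes "j < n"
  shows "transpose_mat (lower_bidiag_mat n \<gamma> \<delta>) *\<^sub>v unit_vec n j =
    \<gamma> (Suc j) \<cdot>\<^sub>v unit_vec n j + \<delta> (Suc j) \<cdot>\<^sub>v (case j of 0 \<Rightarrow> 0\<^sub>v n | Suc i \<Rightarrow> unit_vec n i)"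
proof -
  have T: "transpose_mat (lower_bidiag_mat n \<gamma> \<delta>) \<in> carrier_mat n n"
    by (simp add: lower_bidiag_mat_def)
  show ?thesis
    unfolding mult_mat_unit_vec[OF T assms]
    using assms by (intro eq_vecI) (auto simp: lower_bidiag_mat_def unit_vec_def split: nat.splits)
qed

theorem theorem6p3:
  fixes p emax n :: nat
    and rnd :: "real \<Rightarrow> real"
    and sm :: "real option list \<Rightarrow> real option"
    and P L A :: "real mat"
    and v :: "real vec"
    and \<gamma> \<delta> :: "nat \<Rightarrow> real"
  assumes "ieee_binary_format p emax"
    and "rounds_to_nearest p emax rnd"
    and "summation_algorithm (fl p emax rnd) sm"
    and "1 \<le> n"
    and "signed_permutation_mat n P"
    and "elements_mat P \<subseteq> fp_numbers p emax"
    and "L = lower_bidiag_mat n \<gamma> \<delta>"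
    and "elements_mat L \<subseteq> fp_numbers p emax"
    and "\<delta> 1 \<in> fp_numbers p emax"
    and "\<And>j. j \<in> {1..n} \<Longrightarrow> 0 < \<gamma> j \<and> 0 < \<delta> j"
    and "\<And>j. j \<in> {1..n} \<Longrightarrow>
           within_exponent_range p emax ((\<gamma> j)\<^sup>2) \<and> within_exponent_range p emax ((\<delta> j)\<^sup>2)"
    and "A = P * L * transpose_mat P"
    and "v = \<delta> 1 \<cdot>\<^sub>v (P *\<^sub>v unit_vec n 0)"
  shows "gk_computes_exactly (fl p emax rnd) sm A v \<and>
    (let R = fp_arith (fl p emax rnd) sm;
         out = golub_kahan R (map_mat Some A) (map_vec Some v)
     in n \<le> length (fst out) \<and> n \<le> length (snd out) \<and> gk_bidiag R n out = map_mat Some L)"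
proof -
  interpret rounding_format p emax rnd sm using assms(1-3) by unfold_locales
  have n: "0 < n" using assms(4) by simp
  have P: "P \<in> carrier_mat n n" using assms(5) by (simp add: signed_permutation_mat_def)
  have L: "L \<in> carrier_mat n n" by (simp add: assms(7) lower_bidiag_mat_carrier)
  have A: "A \<in> carrier_mat n n" using P L by (simp add: assms(12))
  note orth = signed_permutation_mat_orthogonal[OF assms(5)]
  obtain \<pi> where \<pi>: "inj_on \<pi> {..<n}"
    and cols: "\<And>j. j < n \<Longrightarrow> signed_coordinate_vec n (\<pi> j) (col P j)"
    using signed_permutation_mat_columns[OF assms(5)] by blast
  \<comment> \<open>The value at \<^term>\<open>n\<close> is the zero vector and ends the recurrence for \<^term>\<open>A\<close>.\<close>
  define q where "q = (\<lambda>j. P *\<^sub>v unit_vec n j)"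
  have q_col: "q j = col P j" if "j < n" for j
    unfolding q_def by (rule mult_mat_unit_vec[OF P that])
  have q_n: "q n = 0\<^sub>v n"
    using P by (auto simp: q_def scalar_prod_def unit_vec_def)
  have q_entries: "q i $ r \<in> F" if "i < n" "r < n" for i r
    using that P assms(6) elements_matI[OF P that(2,1) refl] by (auto simp: q_col)
  have coeff_\<gamma>: "\<gamma> (Suc i) \<in> F" if "i < n" for i
    using elements_matI[OF L that that refl] assms(8) that by (auto simp: assms(7) lower_bidiag_mat_def)
  have coeff_\<delta>: "\<delta> (Suc i) \<in> F" if "i < n" for i
  proof (cases i)
    case 0
    then show ?thesis using assms(9) by simp
  next
    case (Suc j)
    then show ?thesis
      using elements_matI[OF L that _ refl, of j] assms(8) that
      by (auto simp: assms(7) lower_bidiag_mat_def)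
  qed
  have range: "0 < \<gamma> (Suc i) \<and> within_exponent_range p emax ((\<gamma> (Suc i))\<^sup>2)"
    "0 < \<delta> (Suc i) \<and> within_exponent_range p emax ((\<delta> (Suc i))\<^sup>2)" if "i < n" for i
    using assms(10,11)[of "Suc i"] that by auto
  have T: "transpose_mat L \<in> carrier_mat n n" using L by simp
  have AT: "transpose_mat A = P * transpose_mat L * transpose_mat P"
  proof -
    have "transpose_mat A = P * (transpose_mat L * transpose_mat P)"
      using P L by (simp add: assms(12) transpose_mult[of _ n n _ n])
    then show ?thesis using P T by (simp add: assoc_mult_mat[of _ n n _ n _ n])
  qed
  have smult_add: "P *\<^sub>v (a \<cdot>\<^sub>v x + b \<cdot>\<^sub>v y) = a \<cdot>\<^sub>v (P *\<^sub>v x) + b \<cdot>\<^sub>v (P *\<^sub>v y)"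
    if "x \<in> carrier_vec n" "y \<in> carrier_vec n" for a b :: real and x y
    using P that by (simp add: mult_add_distrib_mat_vec[OF P] mult_mat_vec[OF P])
  have product: "A *\<^sub>v q i = \<delta> (Suc (Suc i)) \<cdot>\<^sub>v q (Suc i) + \<gamma> (Suc i) \<cdot>\<^sub>v q i" if "i < n" for i
    unfolding q_def assms(12) conjugate_mult_mat_vec[OF P L orth unit_vec_carrier]
    unfolding assms(7) lower_bidiag_mat_mult_unit_vec[OF that]
    by (rule smult_add) auto
  have transposed_product: "transpose_mat A *\<^sub>v q i =
      \<gamma> (Suc i) \<cdot>\<^sub>v q i + \<delta> (Suc i) \<cdot>\<^sub>v (case i of 0 \<Rightarrow> 0\<^sub>v n | Suc j \<Rightarrow> q j)" if "i < n" for i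
  proof -
    have "P *\<^sub>v 0\<^sub>v n = 0\<^sub>v n" using P by (auto simp: scalar_prod_def)
    then have "P *\<^sub>v (case i of 0 \<Rightarrow> 0\<^sub>v n | Suc j \<Rightarrow> unit_vec n j) = (case i of 0 \<Rightarrow> 0\<^sub>v n | Suc j \<Rightarrow> q j)"
      by (auto simp: q_def split: nat.splits)
    then show ?thesis
      unfolding AT q_def conjugate_mult_mat_vec[OF P T orth unit_vec_carrier]
      unfolding assms(7) transpose_lower_bidiag_mat_mult_unit_vec[OF that]
      by (subst smult_add) (auto split: nat.splits)
  qed
  have last_product: "A *\<^sub>v q (n - 1) = \<gamma> (Suc (n - 1)) \<cdot>\<^sub>v q (n - 1)"
    using product[of "n - 1"] n q_n P by (auto simp: q_def intro!: eq_vecI)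
  have v: "v = \<delta> (Suc 0) \<cdot>\<^sub>v q 0" by (simp add: assms(13) q_def)
  note runs = golub_kahan_signed_coordinate_vecs[where q = q and k = \<pi>
      and c = "\<lambda>i. \<gamma> (Suc i)" and d = "\<lambda>i. \<delta> (Suc i)" and B = A and n = n, folded v]
  have exact: "golub_kahan exact_arith A v =
      (map (\<lambda>i. GK_Line (\<delta> (Suc i) \<cdot>\<^sub>v q i) (\<delta> (Suc i)) (Some (q i))) [0..<n] @ [GK_Line (0\<^sub>v n) 0 None],
       map (\<lambda>i. GK_Line (\<gamma> (Suc i) \<cdot>\<^sub>v q i) (\<gamma> (Suc i)) (Some (q i))) [0..<n])" (is "_ = ?lines")
    using n A \<pi> q_entries coeff_\<gamma> coeff_\<delta> range product transposed_product last_product cols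
    by (intro runs(1)) (auto simp: q_col)
  have fp: "golub_kahan (fp_arith f sm) (map_mat Some A) (map_vec Some v) =
      map_prod (map line_some) (map line_some) ?lines"
    using n A \<pi> q_entries coeff_\<gamma> coeff_\<delta> range product transposed_product last_product cols
    by (intro runs(2)) (auto simp: q_col)
  have "gk_bidiag (fp_arith f sm) n (map_prod (map line_some) (map line_some) ?lines) = map_mat Some L"
    by (intro eq_matI)
      (auto simp: gk_bidiag_def assms(7) lower_bidiag_mat_def line_some_def nth_append fp_arith_def)
  then show ?thesis
    using exact fp by (simp add: gk_computes_exactly_def Let_def)
qed

end
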